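(* Let $n\ge2$ and $N\ge1$ be integers, let $\nu>0$, and let all natural frequencies be equal, $\nu_i=\nu$ for $i=1,\dots,N$. Suppose that $\kappa$, $\alpha$ and the initial data satisfy $$0<\kappa<\frac{\nu}{2^{n+1}a_n},$$ $$0<\alpha<\left(\frac{\pi}{2^{n+1}a_n}\frac{n}{n+1}-\frac1{2^n}\right)\frac{1}{\sqrt{2n-1}}\left(\frac{2n}{2n-1}\right)^{n-1},$$ $$R(0)<\alpha\exp\left[-\alpha\sqrt{2n-1}\left(\frac{2n-1}{2n}\right)^{n-1}-\frac1{2^{n-1}}\right].$$ Let $\Theta(t)$ be a global solution of the Winfree model of order $n$. Then there exist positive constants $\tilde\beta_1,\tilde\beta_2,\tilde\Lambda_1,\tilde\Lambda_2$ such that $$\tilde\beta_1e^{-\tilde\Lambda_1t}R(0)\ \le\ R(t)\ \le\ \tilde\beta_2e^{-\tilde\Lambda_2t}R(0)\ <\ \alpha,\qquad t\ge0.$$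
   Context: For an integer $n\ge1$ put $a_n=\frac{(2n)!!}{2^n(2n-1)!!}$, $I_n(\theta)=a_n(1+\cos\theta)^n=2^na_n\cos^{2n}\frac{\theta}{2}$ and $S(\theta)=-\sin\theta$. The Winfree model of order $n$ with natural frequencies $\nu_1,\dots,\nu_N\in\mathbb R$ and coupling strength $\kappa$ is the ODE system on $\mathbb R^N$ $$\dot\theta_i=\nu_i+\frac{\kappa}{N}\sum_{j=1}^N I_n(\theta_j)S(\theta_i),\qquad i=1,\dots,N.$$ For a solution $\Theta(t)=(\theta_1(t),\dots,\theta_N(t))\in\mathbb R^N$ set $R(t):=\frac12\left(\max_i\theta_i(t)-\min_i\theta_i(t)\right)$. As $n\to\infty$, the upper bound on $\kappa$ is of order $\nu/\sqrt n$ and the upper bound on $\alpha$ is of order $1/n$. *)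

theory Defs
  imports "HOL-Analysis.Analysis"
begin

fun double_fact :: "nat \<Rightarrow> nat" where
  "double_fact 0 = 1"
| "double_fact (Suc 0) = 1"
| "double_fact (Suc (Suc k)) = Suc (Suc k) * double_fact k"

definition winfree_coeff :: "nat \<Rightarrow> real" where
  "winfree_coeff n = real (double_fact (2 * n)) / (2 ^ n * real (double_fact (2 * n - 1)))"

definition influence :: "nat \<Rightarrow> real \<Rightarrow> real" where
  "influence n \<theta> = winfree_coeff n * (1 + cos \<theta>) ^ n"

definition sensitivity :: "real \<Rightarrow> real" where
  "sensitivity \<theta> = - sin \<theta>"

(* The number N of oscillators is the cardinality of the index type. *)
definition winfree_field ::
  "nat \<Rightarrow> real \<Rightarrow> real ^ 'N \<Rightarrow> real ^ 'N \<Rightarrow> real ^ 'N::finite" where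
  "winfree_field n \<kappa> \<nu> \<theta> =
     (\<chi> i. \<nu> $ i + \<kappa> / real CARD('N) *
        (\<Sum>j\<in>UNIV. influence n (\<theta> $ j) * sensitivity (\<theta> $ i)))"

(* A solution on [0, \<infinity>), with the one-sided derivative at t = 0.
   Values of \<Theta> at negative times are irrelevant. *)
definition winfree_global_solution ::
  "nat \<Rightarrow> real \<Rightarrow> real ^ 'N \<Rightarrow> (real \<Rightarrow> real ^ 'N::finite) \<Rightarrow> bool" where
  "winfree_global_solution n \<kappa> \<nu> \<Theta> \<longleftrightarrow>
     (\<forall>t\<ge>0. (\<Theta> has_vector_derivative winfree_field n \<kappa> \<nu> (\<Theta> t)) (at t within {0..}))"

definition half_diameter :: "real ^ 'N::finite \<Rightarrow> real" where
  "half_diameter \<theta> = ((MAX i. \<theta> $ i) - (MIN i. \<theta> $ i)) / 2"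

end

(* All phases solve one scalar equation d theta/dt = nu * (1 - k * m(t) * sin theta), where m(t) is
   the mean influence scaled to [0,1] and k < 1/2.  Hence the order of the phases is preserved, the
   diameter shrinks at most exponentially, and the midpoint phi of the extremal phases rotates with
   speed at least nu/2.  Moreover (ln tan(R/2))' = - nu * k * m * cos phi.  As long as R <= alpha,
   m is within epsilon of ((1 + cos phi)/2)^n, so d(ln tan(R/2))/d phi is bounded by k times an
   explicit 2 pi-periodic function g.  The upper bound on alpha makes the integral of g over a period
   negative, and the positive part of g integrates over a period to at most twice the exponent in the
   hypothesis on R(0).  The former gives exponential decay; the latter shows that R never reaches
   alpha. *)

theory Submission
  imports Defs
begin

text \<open>The estimate of m needs R <= \<alpha>, which is itself part of the claim; the circle is
  broken by continuity, at the first time at which R would reach \<alpha>. Two facts make the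
  hypothesis on R(0) sufficient as it stands: the factor k < 1/2 cancels the word "twice" above, and
  convexity of tan carries a bound for tan(R/2) back to R without loss. The exponential decay comes
  with a prefactor that may exceed \<alpha>; a weighted geometric mean with the uniform bound brings
  the prefactor below \<alpha> at the price of a smaller rate. The number epsilon is \<alpha> times
  the maximal slope of ((1 + cos x)/2)^n, whose closed form is the source of the factors sqrt(2n-1)
  and ((2n-1)/(2n))^(n-1) in the hypotheses. The terms 1/2^n and 1/2^(n-1) come from the half circle
  cos x <= 0, the only place where R can grow: there ((1 + cos x)/2)^n is at most 1/2^n.\<close>

section \<open>Integrals of periodic functions\<close>

lemma nonincreasing_within:
  fixes f :: "real \<Rightarrow> real"
  assumes "a \<le> b"
    and "\<And>x. a \<le> x \<Longrightarrow> x \<le> b \<Longrightarrow> (f has_real_derivative f' x) (at x within {a..b})"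
    and "\<And>x. a \<le> x \<Longrightarrow> x \<le> b \<Longrightarrow> f' x \<le> 0"
  shows "f b \<le> f a"
proof -
  obtain x where "x \<in> {a..b}" "f b - f a = f' x * (b - a)"
    using mvt_very_simple[of a b f "\<lambda>x. (*) (f' x)"] assms(1,2)
    by (auto simp: has_field_derivative_def)
  moreover from this have "f' x * (b - a) \<le> 0"
    using assms(1,3) by (auto intro: mult_nonpos_nonneg)
  ultimately show ?thesis by simp
qed

lemma periodic_integral:
  fixes f :: "real \<Rightarrow> real"
  assumes cont: "continuous_on UNIV f" and per: "\<And>x. f (x + p) = f x" and p: "p \<ge> 0"
  shows "integral {a..a + p} f = integral {b..b + p} f"
proof -
  have le: "integral {a..a + p} f = integral {b..b + p} f" if "a \<le> b" for a b
  proof -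
    have int: "f integrable_on {x..y}" for x y
      using cont continuous_on_subset integrable_continuous_real by blast
    have "(f \<circ> (+) p) = f" using per by (auto simp: add.commute)
    then have "integral {a..b} f = integral {a + p..b + p} f"
      using integral_shift_Icc_real[of a b f p] by simp
    moreover have "integral {a..b} f + integral {b..b + p} f = integral {a..b + p} f"
      using that p by (intro Henstock_Kurzweil_Integration.integral_combine int) auto
    moreover have "integral {a..a + p} f + integral {a + p..b + p} f = integral {a..b + p} f"
      using that p by (intro Henstock_Kurzweil_Integration.integral_combine int) auto
    ultimately show ?thesis by simp
  qed
  show ?thesis using le[of a b] le[of b a] by linarith
qed

text \<open>Cut \<open>{a..b}\<close> into \<open>m\<close> whole periods and a remainder no longer
  than a period. Each whole period contributes at most \<open>- \<gamma>\<close>; the remainder is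
  bounded through the nonnegative majorant \<open>h\<close>, whose integral can only grow when the
  remainder is enlarged to a full period. The second bound loses one \<open>\<gamma>\<close> by
  rounding \<open>(b - a) / p\<close> down. The first bound will confine R, the second will make it
  decay.\<close>

lemma periodic_integral_decay:
  fixes f h :: "real \<Rightarrow> real"
  assumes contf: "continuous_on UNIV f" and perf: "\<And>x. f (x + p) = f x"
    and conth: "continuous_on UNIV h" and perh: "\<And>x. h (x + p) = h x"
    and p: "p > 0" and fh: "\<And>x. f x \<le> h x" and h0: "\<And>x. 0 \<le> h x"
    and If: "integral {0..p} f \<le> - \<gamma>" and Ih: "integral {0..p} h \<le> E"
    and \<gamma>: "\<gamma> \<ge> 0" and ab: "a \<le> b"
  shows "integral {a..b} f \<le> E" and "integral {a..b} f \<le> E + \<gamma> - \<gamma> / p * (b - a)"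
proof -
  have intf: "f integrable_on {x..y}" and inth: "h integrable_on {x..y}" for x y
    using contf conth continuous_on_subset integrable_continuous_real by blast+
  define m where "m = nat \<lfloor>(b - a) / p\<rfloor>"
  define r where "r = b - a - p * real m"
  have m: "real m = of_int \<lfloor>(b - a) / p\<rfloor>"
    using ab p unfolding m_def by simp
  have "real m \<le> (b - a) / p" "(b - a) / p < real m + 1"
    unfolding m by linarith+
  then have r: "0 \<le> r" "r \<le> p"
    using p unfolding r_def by (simp_all add: field_simps)
  have whole: "integral {a..a + p * real k} f \<le> - \<gamma> * real k" for k
  proof (induction k)
    case (Suc k)
    have "integral {a..a + p * real k} f + integral {a + p * real k..a + p * real k + p} f
        = integral {a..a + p * real k + p} f"
      using p by (intro Henstock_Kurzweil_Integration.integral_combine intf) auto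
    moreover have "integral {a + p * real k..a + p * real k + p} f = integral {0..0 + p} f"
      using p by (intro periodic_integral contf perf) auto
    ultimately show ?case using Suc If by (simp add: algebra_simps)
  qed simp
  define c where "c = a + p * real m"
  have b: "b = c + r" unfolding c_def r_def by simp
  have "integral {c..b} f \<le> integral {c..b} h"
    by (intro integral_le intf inth fh)
  also have "\<dots> \<le> integral {c..c + p} h"
    using r unfolding b by (intro integral_subset_le inth) (auto simp: h0)
  also have "\<dots> = integral {0..0 + p} h"
    using p by (intro periodic_integral conth perh) auto
  also have "\<dots> \<le> E" using Ih by simp
  finally have rest: "integral {c..b} f \<le> E" .
  have "integral {a..c} f + integral {c..b} f = integral {a..b} f"
    using p r unfolding b by (intro Henstock_Kurzweil_Integration.integral_combine intf) (auto simp: c_def)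
  then have main: "integral {a..b} f \<le> E - \<gamma> * real m"
    using whole[of m] rest unfolding c_def by simp
  then show "integral {a..b} f \<le> E"
    using \<gamma> by (smt (verit) mult_nonneg_nonneg of_nat_0_le_iff)
  have "\<gamma> / p * (b - a) = \<gamma> * real m + \<gamma> * (r / p)"
    using p unfolding r_def by (simp add: field_simps)
  moreover have "\<gamma> * (r / p) \<le> \<gamma> * 1"
    using r p \<gamma> by (intro mult_left_mono) auto
  ultimately show "integral {a..b} f \<le> E + \<gamma> - \<gamma> / p * (b - a)"
    using main by simp
qed

section \<open>The normalized influence function\<close>

definition hump :: "nat \<Rightarrow> real \<Rightarrow> real" where
  "hump n x = ((1 + cos x) / 2) ^ n"

text \<open>This is (2n)!!/(2n-1)!!, the maximum of the influence function; its reciprocal is the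
  mean of \<open>hump n\<close> over a period.\<close>

definition wallis_ratio :: "nat \<Rightarrow> real" where
  "wallis_ratio n = 2 ^ n * winfree_coeff n"

lemma influence_eq_hump: "influence n x = wallis_ratio n * hump n x"
  by (simp add: influence_def wallis_ratio_def hump_def power_divide)

lemma continuous_on_hump [continuous_intros]: "continuous_on S (hump n)"
  unfolding hump_def by (intro continuous_intros) auto

lemma hump_periodic: "hump n (x + 2 * pi) = hump n x"
  by (simp add: hump_def)

lemma one_plus_cos_nonneg: "0 \<le> 1 + cos (x :: real)"
  using cos_ge_minus_one[of x] by linarith

lemma hump_nonneg: "0 \<le> hump n x"
  unfolding hump_def using one_plus_cos_nonneg[of x] by (intro zero_le_power) simp

lemma hump_le_1: "hump n x \<le> 1"
  unfolding hump_def using one_plus_cos_nonneg[of x] cos_le_one[of x]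
  by (intro power_le_one) simp_all

lemma hump_le_half_power:
  assumes "cos x \<le> 0"
  shows "hump n x \<le> 1 / 2 ^ n"
  unfolding power_one_over[symmetric] hump_def
  using one_plus_cos_nonneg[of x] assms by (intro power_mono) simp_all

section \<open>Recurrence and bounds for (2n)!!/(2n-1)!!\<close>

lemma double_fact_pos: "double_fact n > 0"
  by (induction n rule: double_fact.induct) auto

lemma wallis_ratio_eq: "wallis_ratio n = real (double_fact (2 * n)) / real (double_fact (2 * n - 1))"
  by (simp add: wallis_ratio_def winfree_coeff_def)

lemma wallis_ratio_0: "wallis_ratio 0 = 1"
  by (simp add: wallis_ratio_eq)

lemma wallis_ratio_Suc:
  "wallis_ratio (Suc n) = wallis_ratio n * (2 * real n + 2) / (2 * real n + 1)"
\<comment> \<open>For \<open>n = 0\<close> the truncated \<open>2 * n - 1\<close> is 0, and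
  \<open>double_fact 0 = 1\<close> agrees with the convention (-1)!! = 1.\<close>
proof (cases n)
  case 0
  then show ?thesis by (simp add: wallis_ratio_eq numeral_2_eq_2)
next
  case (Suc m)
  have "double_fact (2 * Suc n) = (2 * n + 2) * double_fact (2 * n)" by simp
  moreover have "2 * Suc n - 1 = Suc (Suc (2 * n - 1))" using Suc by simp
  then have "double_fact (2 * Suc n - 1) = (2 * n + 1) * double_fact (2 * n - 1)"
    using Suc by (simp only: double_fact.simps) simp
  ultimately show ?thesis unfolding wallis_ratio_eq by (simp add: algebra_simps)
qed

lemma wallis_ratio_pos: "wallis_ratio n > 0"
  by (simp add: wallis_ratio_eq double_fact_pos)

lemma wallis_ratio_ge_2: "n \<ge> 1 \<Longrightarrow> wallis_ratio n \<ge> 2"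
proof (induction n rule: dec_induct)
  case base
  show ?case using wallis_ratio_Suc[of 0] by (simp add: wallis_ratio_0)
next
  case (step n)
  have "wallis_ratio n * (2 * real n + 1) \<le> wallis_ratio n * (2 * real n + 2)"
    using wallis_ratio_pos[of n] by (intro mult_left_mono) auto
  then have "wallis_ratio n \<le> wallis_ratio (Suc n)"
    unfolding wallis_ratio_Suc by (simp add: pos_le_divide_eq)
  then show ?case using step by simp
qed

text \<open>The true order is sqrt(n), but a linear bound is enough: its reciprocal only has to beat
  a term of order 1/n in \<open>integral_growth_rate_neg\<close>. Equality holds at
  \<open>n = 2\<close>.\<close>

lemma wallis_ratio_le:  "n \<ge> 2 \<Longrightarrow> wallis_ratio n \<le> 4 / 3 * real n"
proof (induction n rule: dec_induct)
  case base
  show ?case using wallis_ratio_Suc[of 0] wallis_ratio_Suc[of 1]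
    by (simp add: wallis_ratio_0 numeral_2_eq_2)
next
  case (step n)
  have "wallis_ratio n * (2 * real n + 2) \<le> 4 / 3 * real n * (2 * real n + 2)"
    using step by (intro mult_right_mono) auto
  also have "\<dots> \<le> 4 / 3 * real (Suc n) * (2 * real n + 1)"
    by (simp add: algebra_simps)
  finally show ?case unfolding wallis_ratio_Suc by (simp add: pos_divide_le_eq)
qed

text \<open>With u = (1 + cos x)/2, the derivative of sin x * u^n is (2n+2) u^(n+1) - (2n+1) u^n.
  Since sin vanishes at both ends of the period, integrating gives the recurrence of
  \<open>wallis_ratio_Suc\<close>.\<close>

lemma has_integral_hump: "(hump n has_integral 2 * pi / wallis_ratio n) {0..2 * pi}"
proof (induction n)
  case 0
  show ?case using has_integral_const_real[of "1::real" 0 "2 * pi"]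
    by (simp add: hump_def wallis_ratio_0)
next
  case (Suc n)
  have "((\<lambda>x. (2 * real n + 2) * hump (Suc n) x - (2 * real n + 1) * hump n x) has_integral
      sin (2 * pi) * ((1 + cos (2 * pi)) / 2) ^ n - sin 0 * ((1 + cos 0) / 2) ^ n) {0..2 * pi}"
  proof (rule fundamental_theorem_of_calculus)
    fix x :: real
    define u where "u = (1 + cos x) / 2"
    have cosx: "cos x = 2 * u - 1" by (simp add: u_def field_simps)
    have s2: "sin x * sin x = 4 * (u - u * u)"
      using sin_cos_squared_add3[of x] unfolding cosx by (simp add: algebra_simps)
    have deriv: "((\<lambda>x. sin x * ((1 + cos x) / 2) ^ n) has_real_derivative
        cos x * u ^ n - sin x * sin x / 2 * (real n * u ^ (n - 1))) (at x within {0..2 * pi})"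
      unfolding u_def by (auto intro!: derivative_eq_intros simp: algebra_simps)
    \<comment> \<open>The factor \<open>real n\<close> makes this true for \<open>n = 0\<close> as
      well, where \<open>n - 1\<close> is truncated.\<close>
    have nu: "real n * (u ^ (n - 1) * u) = real n * u ^ n"
      by (cases n) (auto simp: mult.commute)
    have "4 * (u - u * u) / 2 * (m * v) = 2 * (1 - u) * (m * (v * u))" for m v
      by (simp add: field_simps)
    then have "sin x * sin x / 2 * (real n * u ^ (n - 1)) = 2 * (1 - u) * (real n * u ^ n)"
      unfolding s2 nu[symmetric] .
    then have "cos x * u ^ n - sin x * sin x / 2 * (real n * u ^ (n - 1))
        = (2 * real n + 2) * hump (Suc n) x - (2 * real n + 1) * hump n x"
      by (simp add: hump_def u_def[symmetric] cosx algebra_simps)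
    then show "((\<lambda>x. sin x * ((1 + cos x) / 2) ^ n) has_vector_derivative
        (2 * real n + 2) * hump (Suc n) x - (2 * real n + 1) * hump n x)
        (at x within {0..2 * pi})"
      using deriv by (simp add: has_real_derivative_iff_has_vector_derivative)
  qed simp
  then have diff: "((\<lambda>x. (2 * real n + 2) * hump (Suc n) x - (2 * real n + 1) * hump n x)
      has_integral 0) {0..2 * pi}" by simp
  have "((\<lambda>x. (2 * real n + 1) * hump n x) has_integral
      (2 * real n + 1) * (2 * pi / wallis_ratio n)) {0..2 * pi}"
    using Suc by (rule has_integral_mult_right)
  from has_integral_add[OF diff this]
  have "((\<lambda>x. (2 * real n + 2) * hump (Suc n) x) has_integral
      (2 * real n + 1) * (2 * pi / wallis_ratio n)) {0..2 * pi}" by simp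
  from has_integral_mult_right[OF this, of "1 / (2 * real n + 2)"]
  have "(hump (Suc n) has_integral
      1 / (2 * real n + 2) * ((2 * real n + 1) * (2 * pi / wallis_ratio n))) {0..2 * pi}"
    by (simp only: mult.assoc[symmetric]) (simp add: add_pos_nonneg)
  then show ?case unfolding wallis_ratio_Suc by (simp add: field_simps)
qed

text \<open>Since cos x = 2u - 1 with u = (1 + cos x)/2, the integrand is a combination of two
  consecutive humps. This is the source of the factor n/(n+1) in the bound on \<alpha>.\<close>

lemma has_integral_hump_cos:
  "((\<lambda>x. hump n x * cos x) has_integral 2 * pi / wallis_ratio n * (real n / (real n + 1)))
     {0..2 * pi}"
proof -
  have "((\<lambda>x. 2 * hump (Suc n) x - hump n x) has_integral
      2 * (2 * pi / wallis_ratio (Suc n)) - 2 * pi / wallis_ratio n) {0..2 * pi}"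
    by (intro has_integral_diff has_integral_mult_right has_integral_hump)
  moreover have "2 * hump (Suc n) x - hump n x = hump n x * cos x" for x
    by (simp add: hump_def field_simps)
  moreover have "2 * (2 * pi / wallis_ratio (Suc n)) - 2 * pi / wallis_ratio n
      = 2 * pi / wallis_ratio n * (real n / (real n + 1))"
    unfolding wallis_ratio_Suc using wallis_ratio_pos[of n] by (simp add: divide_simps) (simp add: algebra_simps)
  ultimately show ?thesis by simp
qed

text \<open>\<open>F\<close> is an antiderivative without the absolute value; sin changes sign at
  pi, where \<open>F\<close> vanishes, so each half period contributes 2/(n+1).\<close>

lemma has_integral_hump_abs_sin:
  "((\<lambda>x. hump n x * \<bar>sin x\<bar>) has_integral 4 / (real n + 1)) {0..2 * pi}"
proof -
  define F where "F x = - 2 / (real n + 1) * ((1 + cos x) / 2) ^ Suc n" for x :: real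
  have F: "(F has_vector_derivative hump n x * sin x) (at x within S)" for x S
  proof -
    have "((\<lambda>x. ((1 + cos x) / 2) ^ Suc n) has_real_derivative
        (real n + 1) * ((1 + cos x) / 2) ^ n * (- sin x / 2)) (at x within S)"
      by (auto intro!: derivative_eq_intros simp del: power_Suc)
    from DERIV_cmult[OF this, of "- 2 / (real n + 1)"]
    have "(F has_real_derivative - 2 / (real n + 1)
        * ((real n + 1) * ((1 + cos x) / 2) ^ n * (- sin x / 2))) (at x within S)"
      by (simp only: F_def[abs_def])
    moreover have "- 2 / (real n + 1) * ((real n + 1) * h * (- s / 2)) = h * s" for h s
      by (simp add: field_simps)
    ultimately show ?thesis
      by (simp only: hump_def has_real_derivative_iff_has_vector_derivative)
  qed
  have "((\<lambda>x. hump n x * sin x) has_integral F pi - F 0) {0..pi}"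
    using F by (intro fundamental_theorem_of_calculus) auto
  then have 1: "((\<lambda>x. hump n x * \<bar>sin x\<bar>) has_integral F pi - F 0) {0..pi}"
    by (rule has_integral_eq[rotated]) (simp add: sin_ge_zero)
  have "((\<lambda>x. - (hump n x * sin x)) has_integral - (F (2 * pi) - F pi)) {pi..2 * pi}"
    using F by (intro has_integral_neg fundamental_theorem_of_calculus) auto
  then have 2: "((\<lambda>x. hump n x * \<bar>sin x\<bar>) has_integral - (F (2 * pi) - F pi)) {pi..2 * pi}"
    by (rule has_integral_eq[rotated]) (use sin_le_zero in \<open>force simp: abs_if\<close>)
  have "F pi - F 0 + - (F (2 * pi) - F pi) = 4 / (real n + 1)"
    by (simp add: F_def)
  then show ?thesis using has_integral_combine[OF _ _ 1 2] by simp
qed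

lemma integral_max_minus_cos: "integral {0..2 * pi} (\<lambda>x. max 0 (- cos x)) = 2"
proof -
  let ?q = "\<lambda>x::real. max 0 (- cos x)"
  have F: "(sin has_vector_derivative cos x) (at x within S)" for x :: real and S
    unfolding has_real_derivative_iff_has_vector_derivative[symmetric]
    by (auto intro!: derivative_eq_intros)
  have "((\<lambda>x. 0) has_integral 0) {- (pi / 2)..pi / 2}" by simp
  then have 1: "(?q has_integral 0) {- (pi / 2)..pi / 2}"
    by (rule has_integral_eq[rotated]) (simp add: cos_ge_zero)
  have "((\<lambda>x. - cos x) has_integral - (sin (3 * pi / 2) - sin (pi / 2))) {pi / 2..3 * pi / 2}"
    using F by (intro has_integral_neg fundamental_theorem_of_calculus) auto
  moreover have "- cos x = ?q x" if "x \<in> {pi / 2..3 * pi / 2}" for x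
    using cos_ge_zero[of "x - pi"] that by (auto simp: cos_diff)
  ultimately have 2: "(?q has_integral - (sin (3 * pi / 2) - sin (pi / 2))) {pi / 2..3 * pi / 2}"
    by (rule has_integral_eq[rotated])
  \<comment> \<open>On the period starting at -pi/2 the cosine changes sign only once inside, at
    pi/2; periodicity then moves the result to \<open>{0..2 * pi}\<close>.\<close>
  have "integral {- (pi / 2)..3 * pi / 2} ?q = - (sin (3 * pi / 2) - sin (pi / 2))"
    using has_integral_combine[OF _ _ 1 2] by (auto intro!: integral_unique)
  also have "\<dots> = 2" using sin_3over2_pi by simp
  finally have "integral {- (pi / 2)..- (pi / 2) + 2 * pi} ?q = 2"
    by (simp add: algebra_simps)
  moreover have "integral {- (pi / 2)..- (pi / 2) + 2 * pi} ?q = integral {0..0 + 2 * pi} ?q"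
    by (intro periodic_integral continuous_intros) auto
  ultimately show ?thesis by simp
qed

text \<open>The right-hand side is the maximum, attained at u = m/(m+1). Rescaling by y = (m+1)u/m
  moves the maximum to y = 1 and leaves the inequality \<open>key\<close>. Its induction step is y
  times the induction hypothesis plus (y - 1)(y^(m+1) - 1) >= 0.\<close>

lemma power_mult_complement_le:
  fixes u :: real
  assumes "0 \<le> u"
  shows "u ^ m * (1 - u) \<le> real m ^ m / (real m + 1) ^ (m + 1)"
proof -
  have key: "(real m + 1) * y ^ m \<le> real m * y ^ (m + 1) + 1" if "0 \<le> y" for y :: real
  proof (induction m)
    case (Suc m)
    have "0 \<le> (y - 1) * (y ^ (m + 1) - 1)"
    proof (cases "y \<le> 1")
      case True
      then have "y ^ (m + 1) \<le> 1" using that by (intro power_le_one) auto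
      then show ?thesis using True by (intro mult_nonpos_nonpos) auto
    next
      case False
      then have "1 \<le> y ^ (m + 1)" by (intro one_le_power) auto
      then show ?thesis using False by (intro mult_nonneg_nonneg) auto
    qed
    moreover have "0 \<le> y * (real m * y ^ (m + 1) + 1 - (real m + 1) * y ^ m)"
      using Suc that by (intro mult_nonneg_nonneg) auto
    ultimately show ?case by (simp add: algebra_simps)
  qed simp
  show ?thesis
  proof (cases "m = 0")
    case True
    then show ?thesis using assms by simp
  next
    case False
    define y where "y = (real m + 1) * u / real m"
    have u: "u = real m * y / (real m + 1)" and y: "0 \<le> y"
      using False assms by (simp_all add: y_def)
    have "u ^ m * (1 - u)
        = real m ^ m / (real m + 1) ^ (m + 1) * ((real m + 1) * y ^ m - real m * y ^ (m + 1))"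
      unfolding u by (simp add: divide_simps power_mult_distrib) (simp add: algebra_simps)
    also have "\<dots> \<le> real m ^ m / (real m + 1) ^ (m + 1) * 1"
      using key[OF y] by (intro mult_left_mono) auto
    finally show ?thesis by simp
  qed
qed

text \<open>Twice the maximum of the absolute value of the derivative of \<open>hump n\<close>; the
  doubling makes it the factor next to \<alpha> in the hypothesis on R(0).\<close>

definition hump_slope :: "nat \<Rightarrow> real" where
  "hump_slope n = sqrt (2 * real n - 1) * ((2 * real n - 1) / (2 * real n)) ^ (n - 1)"

text \<open>In terms of u = (1 + cos z)/2 one has (sin z / 2)^2 = u (1 - u), so the squared
  derivative is n^2 u^(2n-1) (1 - u), which \<open>power_mult_complement_le\<close> maximizes with m
  = 2n-1.\<close>

lemma hump_lipschitz:
  assumes "n \<ge> 1"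
  shows "\<bar>hump n x - hump n y\<bar> \<le> hump_slope n / 2 * \<bar>x - y\<bar>"
proof -
  define d where "d z = - (real n * ((1 + cos z) / 2) ^ (n - 1) * (sin z / 2))" for z :: real
  have "(hump n has_real_derivative d z) (at z)" for z
    unfolding hump_def[abs_def] d_def by (auto intro!: derivative_eq_intros)
  moreover have "norm (d z) \<le> hump_slope n / 2" for z
  proof (rule power2_le_imp_le)
    define u where "u = (1 + cos z) / 2"
    define m where "m = 2 * n - 1"
    have rm: "real m = 2 * real n - 1" "m = Suc (2 * (n - 1))"
      using assms by (simp_all add: m_def of_nat_diff)
    have cosz: "cos z = 2 * u - 1" by (simp add: u_def field_simps)
    have "(sin z / 2)\<^sup>2 = u * (1 - u)"
      using sin_squared_eq[of z] unfolding cosz by (simp add: field_simps power2_eq_square)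
    moreover have "(norm (d z))\<^sup>2 = (real n)\<^sup>2 * ((u ^ (n - 1))\<^sup>2 * (sin z / 2)\<^sup>2)"
      unfolding d_def u_def[symmetric] real_norm_def power2_abs
      by (simp only: power2_minus power_mult_distrib mult_ac)
    moreover have "u ^ m = (u ^ (n - 1))\<^sup>2 * u"
      unfolding rm(2) by (simp add: power_mult[symmetric] mult.commute)
    ultimately have "(norm (d z))\<^sup>2 = (real n)\<^sup>2 * (u ^ m * (1 - u))" by simp
    also have "\<dots> \<le> (real n)\<^sup>2 * (real m ^ m / (real m + 1) ^ (m + 1))"
      using one_plus_cos_nonneg[of z] unfolding u_def
      by (intro mult_left_mono power_mult_complement_le) auto
    also have "\<dots> = (hump_slope n / 2)\<^sup>2"
    proof -
      have "(hump_slope n)\<^sup>2 = real m * ((real m / (2 * real n)) ^ (n - 1))\<^sup>2"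
        using assms unfolding hump_slope_def rm(1)[symmetric] by (simp add: power_mult_distrib)
      also have "\<dots> = real m ^ m / (2 * real n) ^ (2 * (n - 1))"
        unfolding rm(2) power_mult[symmetric] mult.commute[of "n - 1" 2] by (simp add: power_divide)
      finally have "(hump_slope n / 2)\<^sup>2 = real m ^ m / (2 * real n) ^ (2 * (n - 1)) / 4"
        by (simp add: power_divide)
      moreover have "real m + 1 = 2 * real n" "m + 1 = 2 * (n - 1) + 2"
        using rm by simp_all
      then have "(real m + 1) ^ (m + 1) = (2 * real n) ^ (2 * (n - 1)) * (2 * real n)\<^sup>2"
        by (simp only: power_add)
      ultimately show ?thesis using assms by (simp add: field_simps power2_eq_square)
    qed
    finally show "(norm (d z))\<^sup>2 \<le> (hump_slope n / 2)\<^sup>2" .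
  qed (use assms in \<open>simp add: hump_slope_def\<close>)
  ultimately show ?thesis
    using field_differentiable_bound[of UNIV "hump n" d "hump_slope n / 2" x y]
    by (simp add: dist_norm)
qed

lemma hump_slope_ge_half:
  assumes "n \<ge> 1"
  shows "hump_slope n \<ge> 1 / 2"
proof -
  have "1 / 2 \<le> 1 + real (n - 1) * (- 1 / (2 * real n))"
    using assms by (simp add: field_simps of_nat_diff)
  also have "\<dots> \<le> (1 + (- 1 / (2 * real n))) ^ (n - 1)"
    using assms by (intro Bernoulli_inequality) (simp add: field_simps)
  also have "1 + (- 1 / (2 * real n)) = (2 * real n - 1) / (2 * real n)"
    using assms by (simp add: field_simps)
  finally have "1 / 2 \<le> ((2 * real n - 1) / (2 * real n)) ^ (n - 1)" .
  moreover have "1 \<le> sqrt (2 * real n - 1)" using assms by simp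
  ultimately have "1 * (1 / 2) \<le> hump_slope n"
    unfolding hump_slope_def by (intro mult_mono) auto
  then show ?thesis by simp
qed

section \<open>The angular growth rate\<close>

text \<open>With \<open>\<phi>\<close> the midpoint of the extremal phases, \<open>growth_rate\<close> bounds the derivative of
  \<open>ln (tan (R / 2))\<close> with respect to \<open>\<phi>\<close>, divided by \<open>k\<close>.  For \<open>cos x \<le> 0\<close> the factor 2 pays for
  a speed of \<open>\<phi>\<close> between \<open>\<nu> / 2\<close> and \<open>\<nu>\<close>; for \<open>cos x > 0\<close> the quadratic term pays for a speed
  above \<open>\<nu>\<close>.\<close>

definition growth_rate :: "nat \<Rightarrow> real \<Rightarrow> real \<Rightarrow> real" where
  "growth_rate n \<epsilon> x = 2 * (hump n x + \<epsilon>) * max 0 (- cos x)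
     - max 0 (hump n x - \<epsilon> - (hump n x)\<^sup>2 * \<bar>sin x\<bar> / 2) * max 0 (cos x)"

lemma continuous_on_growth_rate [continuous_intros]: "continuous_on S (growth_rate n \<epsilon>)"
  unfolding growth_rate_def by (intro continuous_intros) auto

lemma growth_rate_periodic: "growth_rate n \<epsilon> (x + 2 * pi) = growth_rate n \<epsilon> x"
  by (simp add: growth_rate_def hump_periodic)

text \<open>Here \<open>c\<close> is the mean influence and \<open>r\<close> stands for
  \<open>cos (R t)\<close>, so the last factor is the speed of the midpoint in units of the
  frequency and lies between 1/2 and 3/2. For \<open>cos x \<le> 0\<close> only its lower bound
  matters, for \<open>cos x > 0\<close> only an upper bound.\<close>

lemma growth_rate_dominates:
  assumes k: "0 \<le> k" "k \<le> 1 / 2" and c: "0 \<le> c" "c \<le> 1"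
    and close: "\<bar>c - hump n x\<bar> \<le> \<epsilon>" and r: "0 \<le> r" "r \<le> 1"
  shows "- (c * cos x) \<le> growth_rate n \<epsilon> x * (1 - k * c * sin x * r)"
proof -
  define w where "w = hump n x"
  define s where "s = \<bar>sin x\<bar>"
  have w: "0 \<le> w" "w \<le> 1" "c \<le> w + \<epsilon>" "w - \<epsilon> \<le> c"
    using hump_nonneg hump_le_1 close unfolding w_def by (auto simp: abs_if split: if_splits)
  have s: "0 \<le> s" "s \<le> 1" by (simp_all add: s_def)
  have "k * c * r \<le> 1 / 2 * 1 * 1"
    using k c r by (intro mult_mono) auto
  moreover have "0 \<le> k * c * r" using k c r by simp
  moreover have "\<bar>k * c * sin x * r\<bar> = k * c * r * s"
    using k c r by (simp add: abs_mult s_def)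
  ultimately have "\<bar>k * c * sin x * r\<bar> \<le> 1 / 2"
    using s mult_mono[of "k * c * r" "1 / 2" s 1] by simp
  then have half: "1 / 2 \<le> 1 - k * c * sin x * r" by linarith
  show ?thesis
  proof (cases "cos x \<le> 0")
    case True
    have "c * (- cos x) \<le> (w + \<epsilon>) * (- cos x)"
      using True w by (intro mult_right_mono) auto
    also have "\<dots> = 2 * (w + \<epsilon>) * (- cos x) * (1 / 2)" by simp
    also have "\<dots> \<le> 2 * (w + \<epsilon>) * (- cos x) * (1 - k * c * sin x * r)"
      using True w c half by (intro mult_left_mono mult_nonneg_nonneg) auto
    finally show ?thesis using True unfolding growth_rate_def w_def by simp
  next
    case False
    define y where "y = max 0 (w - \<epsilon> - w\<^sup>2 * s / 2)"
    have "y * (1 - k * c * sin x * r) \<le> c"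
    proof (cases "y = 0")
      case False
      then have y: "0 < y" "y = w - \<epsilon> - w\<^sup>2 * s / 2"
        unfolding y_def by (auto simp: max_def split: if_splits)
      have \<epsilon>: "0 \<le> \<epsilon>" using close by linarith
      then have yw: "y \<le> w" and x0: "0 \<le> w - \<epsilon>"
        using y zero_le_power2[of w] mult_nonneg_nonneg[OF zero_le_power2[of w] s(1)] by linarith+
      have "k * c * r * s \<le> k * c * 1 * s"
        using k c r s by (intro mult_mono mult_right_mono) auto
      then have "1 - k * c * sin x * r \<le> 1 + k * c * s"
        using \<open>\<bar>k * c * sin x * r\<bar> = k * c * r * s\<close> by linarith
      then have "y * (1 - k * c * sin x * r) \<le> y * (1 + k * c * s)"
        using y by (intro mult_left_mono) auto
      \<comment> \<open>The speed bound \<open>1 + k * c * s\<close> itself contains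
        \<open>c\<close>. Moving that term across leaves \<open>y \<le> c * (1 - y * k * s)\<close>,
        whose right side increases with \<open>c\<close>, so it suffices to check it at the lower
        bound \<open>w - \<epsilon>\<close>.\<close>
      moreover have "y * k * s * (w - \<epsilon>) \<le> w * (1 / 2) * s * w"
        using y yw k s w x0 \<epsilon> by (intro mult_mono mult_nonneg_nonneg) auto
      then have "y * k * s * (w - \<epsilon>) \<le> (w - \<epsilon>) - y"
        using y(2) by (simp add: power2_eq_square mult_ac)
      then have "y \<le> (w - \<epsilon>) * (1 - y * k * s)"
        by (simp add: right_diff_distrib mult_ac)
      moreover have "y * k * s \<le> 1 * (1 / 2) * 1"
        using y yw k s w by (intro mult_mono mult_nonneg_nonneg) auto
      then have "(w - \<epsilon>) * (1 - y * k * s) \<le> c * (1 - y * k * s)"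
        using w by (intro mult_right_mono) auto
      ultimately show ?thesis by (simp add: algebra_simps)
    qed (use c in simp)
    then have "y * (1 - k * c * sin x * r) * cos x \<le> c * cos x"
      using False by (intro mult_right_mono) auto
    then show ?thesis using False unfolding growth_rate_def w_def y_def s_def
      by (simp add: mult_ac)
  qed
qed

lemma growth_rate_le:
  assumes "0 \<le> \<epsilon>"
  shows "growth_rate n \<epsilon> x \<le> 2 * (1 / 2 ^ n + \<epsilon>) * max 0 (- cos x)"
proof -
  have "hump n x * max 0 (- cos x) \<le> 1 / 2 ^ n * max 0 (- cos x)"
    using mult_right_mono[OF hump_le_half_power[of x n], of "- cos x"] by (cases "cos x \<le> 0") auto
  then have "2 * (hump n x + \<epsilon>) * max 0 (- cos x) \<le> 2 * (1 / 2 ^ n + \<epsilon>) * max 0 (- cos x)"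
    by (simp add: algebra_simps)
  moreover have "0 \<le> max 0 (hump n x - \<epsilon> - (hump n x)\<^sup>2 * \<bar>sin x\<bar> / 2) * max 0 (cos x)"
    by simp
  ultimately show ?thesis unfolding growth_rate_def by linarith
qed

lemma integral_growth_rate_le:
  assumes \<epsilon>: "0 \<le> \<epsilon>"
  shows "integral {0..2 * pi} (growth_rate n \<epsilon>)
    \<le> - (2 * pi / wallis_ratio n * (real n / (real n + 1))) + 2 / 2 ^ n + 6 * \<epsilon> + 2 / (2 * real n + 3)"
proof -
  define q where "q x = max 0 (- cos x)" for x :: real
  \<comment> \<open>Write cos = p - q with positive part p and negative part q. Then 2wq - wp = wq -
    w cos, and the epsilon terms 2q + p equal 3q + cos. The remaining wq is at most q/2^n, so every
    summand has a known integral.\<close>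
  define B where "B x = - (hump n x * cos x) + ((1 / 2 ^ n + 3 * \<epsilon>) * q x + \<epsilon> * cos x
      + 1 / 2 * (hump (2 * n + 2) x * \<bar>sin x\<bar>))" for x
  have le: "growth_rate n \<epsilon> x \<le> B x" for x
  proof -
    define p where "p = max 0 (cos x)"
    define w where "w = hump n x"
    have cosx: "cos x = p - q x" by (simp add: p_def q_def)
    have p0: "0 \<le> p" by (simp add: p_def)
    have "w * q x \<le> 1 / 2 ^ n * q x"
      using mult_right_mono[OF hump_le_half_power[of x n], of "- cos x"] unfolding q_def w_def
      by (cases "cos x \<le> 0") auto
    moreover have "w\<^sup>2 * \<bar>sin x\<bar> * p \<le> hump (2 * n + 2) x * \<bar>sin x\<bar>"
    proof -
      \<comment> \<open>With u = (1 + cos x)/2 this says cos x = 2u - 1 <= u^2, so the factor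
        \<open>p\<close> is absorbed by two more powers of u.\<close>
      have "0 \<le> (1 - (1 + cos x) / 2)\<^sup>2" by (rule zero_le_power2)
      then have "p \<le> ((1 + cos x) / 2)\<^sup>2"
        using zero_le_power2[of "(1 + cos x) / 2"] unfolding p_def
        by (cases "cos x \<le> 0") (simp_all add: power2_eq_square field_simps)
      then have "w\<^sup>2 * \<bar>sin x\<bar> * p \<le> w\<^sup>2 * \<bar>sin x\<bar> * ((1 + cos x) / 2)\<^sup>2"
        by (intro mult_left_mono) auto
      also have "\<dots> = hump (2 * n + 2) x * \<bar>sin x\<bar>"
        unfolding w_def hump_def power_add power_mult mult.commute[of 2 n]
        by (simp only: mult_ac)
      finally show ?thesis .
    qed
    moreover have "(w - \<epsilon> - w\<^sup>2 * \<bar>sin x\<bar> / 2) * p \<le> max 0 (w - \<epsilon> - w\<^sup>2 * \<bar>sin x\<bar> / 2) * p"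
      using p0 by (intro mult_right_mono) auto
    moreover have "growth_rate n \<epsilon> x
        = 2 * (w + \<epsilon>) * q x - max 0 (w - \<epsilon> - w\<^sup>2 * \<bar>sin x\<bar> / 2) * p"
      by (simp add: growth_rate_def w_def q_def p_def)
    ultimately show ?thesis
      unfolding B_def w_def[symmetric] cosx by (simp add: algebra_simps)
  qed
  have q: "(q has_integral 2) {0..2 * pi}"
    using integral_max_minus_cos integrable_integral[of q "{0..2 * pi}"] unfolding q_def[abs_def]
    by (simp add: integrable_continuous_real continuous_intros)
  have "(cos has_integral sin (2 * pi) - sin 0) {0..2 * pi}"
    by (intro fundamental_theorem_of_calculus)
      (auto intro!: derivative_eq_intros simp: has_real_derivative_iff_has_vector_derivative[symmetric])
  then have cos: "(cos has_integral 0) {0..2 * pi}" by simp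
  have intB: "(B has_integral - (2 * pi / wallis_ratio n * (real n / (real n + 1)))
      + ((1 / 2 ^ n + 3 * \<epsilon>) * 2 + \<epsilon> * 0 + 1 / 2 * (4 / (real (2 * n + 2) + 1)))) {0..2 * pi}"
    unfolding B_def
    by (intro has_integral_add has_integral_neg has_integral_mult_right has_integral_hump_cos
        has_integral_hump_abs_sin q cos)
  have intg: "(growth_rate n \<epsilon> has_integral integral {0..2 * pi} (growth_rate n \<epsilon>)) {0..2 * pi}"
    by (intro integrable_integral integrable_continuous_real continuous_intros)
  have "integral {0..2 * pi} (growth_rate n \<epsilon>)
      \<le> - (2 * pi / wallis_ratio n * (real n / (real n + 1)))
      + ((1 / 2 ^ n + 3 * \<epsilon>) * 2 + \<epsilon> * 0 + 1 / 2 * (4 / (real (2 * n + 2) + 1)))"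
    using le by (rule has_integral_le[OF intg intB])
  also have "\<dots> = - (2 * pi / wallis_ratio n * (real n / (real n + 1)))
      + 2 / 2 ^ n + 6 * \<epsilon> + 2 / (2 * real n + 3)"
    by (simp add: add.commute)
  finally show ?thesis .
qed

text \<open>In terms of \<open>P\<close> the assumption reads 2 \<epsilon> < P/2 - 1/2^n. Three
  times this leaves at least P/2 of the gain 2P, and P/2 pays for the speed correction 2/(2n+3),
  because P >= 9/(4(n+1)) by pi > 3 and \<open>wallis_ratio_le\<close>.\<close>

lemma integral_growth_rate_neg:
  assumes n: "n \<ge> 2" and \<epsilon>: "0 \<le> \<epsilon>"
    and small: "2 * \<epsilon> < pi / (2 * wallis_ratio n) * (real n / (real n + 1)) - 1 / 2 ^ n"
  shows "integral {0..2 * pi} (growth_rate n \<epsilon>) < 0"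
proof -
  define P where "P = pi / wallis_ratio n * (real n / (real n + 1))"
  have "integral {0..2 * pi} (growth_rate n \<epsilon>) \<le> - 2 * P + 2 / 2 ^ n + 6 * \<epsilon> + 2 / (2 * real n + 3)"
    using integral_growth_rate_le[OF \<epsilon>, of n] by (simp add: P_def)
  also have "\<dots> < - P / 2 + 2 / (2 * real n + 3)"
  proof -
    have "2 * \<epsilon> < P / 2 - 1 / 2 ^ n" using small unfolding P_def by (simp add: mult_ac)
    moreover have "0 < 1 / (2 :: real) ^ n" by simp
    ultimately show ?thesis by argo
  qed
  also have "\<dots> \<le> 0"
  proof -
    have "pi / (4 / 3 * real n) \<le> pi / wallis_ratio n"
      using wallis_ratio_le[OF n] wallis_ratio_pos[of n] by (intro divide_left_mono) auto
    then have "pi / (4 / 3 * real n) * (real n / (real n + 1)) \<le> P"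
      unfolding P_def by (intro mult_right_mono) auto
    moreover have "pi / (4 / 3 * real n) * (real n / (real n + 1)) = 3 * pi / (4 * (real n + 1))"
      using n by (simp add: divide_simps)
    moreover have "3 * 3 / (4 * (real n + 1)) \<le> 3 * pi / (4 * (real n + 1))"
      using pi_gt3 by (intro divide_right_mono) auto
    moreover have "2 * (2 / (2 * real n + 3)) \<le> 3 * 3 / (4 * (real n + 1))"
      by (simp add: divide_simps)
    ultimately show ?thesis by linarith
  qed
  finally show ?thesis .
qed

lemma growth_rate_integral_bound:
  assumes n: "n \<ge> 2" and \<epsilon>: "0 \<le> \<epsilon>"
    and small: "2 * \<epsilon> < pi / (2 * wallis_ratio n) * (real n / (real n + 1)) - 1 / 2 ^ n"
  obtains C l where "l > 0"
    and "\<And>a b. a \<le> b \<Longrightarrow> integral {a..b} (growth_rate n \<epsilon>) \<le> 4 * (1 / 2 ^ n + \<epsilon>)"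
    and "\<And>a b. a \<le> b \<Longrightarrow> integral {a..b} (growth_rate n \<epsilon>) \<le> C - l * (b - a)"
proof -
  define \<gamma> where "\<gamma> = - integral {0..2 * pi} (growth_rate n \<epsilon>)"
  have \<gamma>: "\<gamma> > 0" using integral_growth_rate_neg[OF assms] by (simp add: \<gamma>_def)
  define h where "h x = 2 * (1 / 2 ^ n + \<epsilon>) * max 0 (- cos x)" for x :: real
  have conth: "continuous_on UNIV h" unfolding h_def by (intro continuous_intros)
  have perh: "h (x + 2 * pi) = h x" and h0: "0 \<le> h x" for x
    using \<epsilon> unfolding h_def by simp_all
  have "integral {0..2 * pi} h = 4 * (1 / 2 ^ n + \<epsilon>)"
    unfolding h_def integral_mult_right integral_max_minus_cos by simp
  then have Ih: "integral {0..2 * pi} h \<le> 4 * (1 / 2 ^ n + \<epsilon>)" by simp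
  have gh: "growth_rate n \<epsilon> x \<le> h x" for x
    using growth_rate_le[OF \<epsilon>] by (simp add: h_def)
  have Ig: "integral {0..2 * pi} (growth_rate n \<epsilon>) \<le> - \<gamma>" by (simp add: \<gamma>_def)
  have "integral {a..b} (growth_rate n \<epsilon>) \<le> 4 * (1 / 2 ^ n + \<epsilon>)"
    "integral {a..b} (growth_rate n \<epsilon>) \<le> 4 * (1 / 2 ^ n + \<epsilon>) + \<gamma> - \<gamma> / (2 * pi) * (b - a)"
    if "a \<le> b" for a b
    using periodic_integral_decay[OF continuous_on_growth_rate growth_rate_periodic conth perh _
        gh h0 Ig Ih less_imp_le[OF \<gamma>] that] by simp_all
  moreover have "\<gamma> / (2 * pi) > 0" using \<gamma> by simp
  ultimately show ?thesis using that by blast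
qed

section \<open>Comparison lemmas\<close>

text \<open>This is convexity of tan together with tan 0 = 0. It converts an inequality tan(R(t)/2)
  <= c tan(R(0)/2) into R(t) <= c R(0).\<close>

lemma scale_tan_le:
  assumes "1 \<le> c" "0 \<le> x" "c * x < pi / 2"
  shows "c * tan x \<le> tan (c * x)"
proof -
  have range: "0 \<le> y" "y \<le> c * y" "c * y < pi / 2" if "0 \<le> y" "y \<le> x" for y
    using that assms mult_left_mono[of y x c] mult_right_mono[of 1 c y] by linarith+
  have "c * tan x - tan (c * x) \<le> c * tan 0 - tan (c * 0)"
  proof (rule nonincreasing_within[of 0 x "\<lambda>y. c * tan y - tan (c * y)"])
    fix y assume y: "0 \<le> y" "y \<le> x"
    note r = range[OF y]
    have pos: "0 < cos y" "0 < cos (c * y)" using r by (auto intro!: cos_gt_zero_pi)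
    then show "((\<lambda>y. c * tan y - tan (c * y)) has_real_derivative
        c * inverse ((cos y)\<^sup>2) - c * inverse ((cos (c * y))\<^sup>2)) (at y within {0..x})"
      by (auto intro!: derivative_eq_intros)
    have "cos (c * y) \<le> cos y" using r by (intro cos_monotone_0_pi_le) auto
    then have "inverse ((cos y)\<^sup>2) \<le> inverse ((cos (c * y))\<^sup>2)"
      using pos by (intro le_imp_inverse_le power_mono) auto
    then show "c * inverse ((cos y)\<^sup>2) - c * inverse ((cos (c * y))\<^sup>2) \<le> 0"
      using assms by (simp add: mult_left_mono)
  qed (use assms in auto)
  then show ?thesis by simp
qed

lemma le_tan:
  assumes "0 \<le> x" "x < pi / 2"
  shows "x \<le> tan x"
proof -
  have "x - tan x \<le> 0 - tan 0"
  proof (rule nonincreasing_within[of 0 x "\<lambda>y. y - tan y"])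
    fix y assume y: "0 \<le> y" "y \<le> x"
    then have pos: "0 < cos y" using assms by (intro cos_gt_zero_pi) auto
    then show "((\<lambda>y. y - tan y) has_real_derivative 1 - inverse ((cos y)\<^sup>2)) (at y within {0..x})"
      by (auto intro!: derivative_eq_intros)
    show "1 - inverse ((cos y)\<^sup>2) \<le> 0"
      using pos by (simp add: one_le_inverse power_le_one)
  qed (use assms in auto)
  then show ?thesis by simp
qed

text \<open>\<open>B2\<close> may exceed \<alpha>. The weighted geometric mean of the two bounds is
  B1^(1-s) B2^s exp(-s l t), and its prefactor tends to B1 < \<alpha> as s tends to 0.\<close>

lemma exp_decay_below_bound:
  fixes R :: "real \<Rightarrow> real"
  assumes B: "0 < B1" "0 < B2" "B1 < \<alpha>" and l: "0 < l"
    and R1: "\<And>t. 0 \<le> t \<Longrightarrow> R t \<le> B1"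
    and R2: "\<And>t. 0 \<le> t \<Longrightarrow> R t \<le> B2 * exp (- l * t)"
  obtains B L where "0 < B" "B < \<alpha>" "0 < L" "\<And>t. 0 \<le> t \<Longrightarrow> R t \<le> B * exp (- L * t)"
proof -
  define b where "b = ln B2 - ln B1"
  define gap where "gap = ln \<alpha> - ln B1"
  \<comment> \<open>Chosen so that \<open>s * b\<close> uses up at most half of \<open>gap\<close>;
    the \<open>+ 1\<close> keeps the denominator positive.\<close>
  define s where "s = min 1 (gap / (2 * (\<bar>b\<bar> + 1)))"
  have gap: "0 < gap" using B by (simp add: gap_def)
  then have s: "0 < s" "s \<le> 1" by (auto simp: s_def)
  have "s * b \<le> s * (\<bar>b\<bar> + 1)"
    using s by (intro mult_left_mono) auto
  also have "\<dots> \<le> gap / (2 * (\<bar>b\<bar> + 1)) * (\<bar>b\<bar> + 1)"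
    by (intro mult_right_mono) (auto simp: s_def)
  also have "\<dots> = gap / 2" by (simp add: divide_simps)
  finally have sb: "s * b < gap" using gap by linarith
  have "exp (ln B1 + s * b) < exp (ln \<alpha>)"
    using sb by (simp add: gap_def)
  then have "exp (ln B1 + s * b) < \<alpha>" using B by simp
  moreover have "R t \<le> exp (ln B1 + s * b) * exp (- (s * l) * t)" if t: "0 \<le> t" for t
  proof -
    have "R t \<le> exp (ln B1)" using R1[OF t] B by simp
    moreover have "R t \<le> exp (ln B2 - l * t)" using R2[OF t] B by (simp add: exp_diff exp_minus field_simps)
    moreover have "min (ln B1) (ln B2 - l * t) \<le> (1 - s) * ln B1 + s * (ln B2 - l * t)"
      using add_mono[OF mult_left_mono[of "min (ln B1) (ln B2 - l * t)" "ln B1" "1 - s"]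
          mult_left_mono[of "min (ln B1) (ln B2 - l * t)" "ln B2 - l * t" s]] s
      by (simp add: left_diff_distrib del: min_le_iff_disj min.absorb_iff1 min.absorb_iff2)
    ultimately have "R t \<le> exp ((1 - s) * ln B1 + s * (ln B2 - l * t))"
      by (smt (verit) exp_le_cancel_iff)
    also have "(1 - s) * ln B1 + s * (ln B2 - l * t) = (ln B1 + s * b) + (- (s * l) * t)"
      by (simp add: b_def algebra_simps)
    finally show ?thesis by (simp only: exp_add)
  qed
  ultimately show ?thesis using that[of "exp (ln B1 + s * b)" "s * l"] s l by simp
qed

text \<open>The assumption controls only absolute values, so the proof works with f^2: f^2 exp(2Kt)
  is nondecreasing, which bounds the absolute value of f from below. If f(0) > 0, then f has no zero
  and keeps its sign; if f(0) = 0, then f^2 exp(-2Kt) is nonincreasing and f stays 0.\<close>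

lemma linear_growth_lower_bound:
  fixes f :: "real \<Rightarrow> real"
  assumes deriv: "\<And>t. 0 \<le> t \<Longrightarrow> (f has_real_derivative f' t) (at t within {0..})"
    and bound: "\<And>t. 0 \<le> t \<Longrightarrow> \<bar>f' t\<bar> \<le> K * \<bar>f t\<bar>"
    and f0: "0 \<le> f 0" and t: "0 \<le> t"
  shows "f 0 * exp (- K * t) \<le> f t"
proof -
  have d: "(f has_real_derivative f' x) (at x within {0..s})" if "0 \<le> x" for x s
    using deriv[OF that] by (rule DERIV_subset) auto
  have ff': "\<bar>f x * f' x\<bar> \<le> K * (f x * f x)" if "0 \<le> x" for x
    using mult_left_mono[OF bound[OF that], of "\<bar>f x\<bar>"] by (simp add: abs_mult mult_ac)
  have low: "(f 0)\<^sup>2 \<le> (f s)\<^sup>2 * exp (2 * K * s)" if s: "0 \<le> s" for s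
  proof -
    have "- ((f s)\<^sup>2 * exp (2 * K * s)) \<le> - ((f 0)\<^sup>2 * exp (2 * K * 0))"
    proof (rule nonincreasing_within[OF s])
      fix x :: real assume x: "0 \<le> x"
      show "((\<lambda>x. - ((f x)\<^sup>2 * exp (2 * K * x))) has_real_derivative
          - (2 * (f x * f' x + K * (f x * f x)) * exp (2 * K * x))) (at x within {0..s})"
        by (rule derivative_eq_intros d[OF x] refl)+ (simp add: algebra_simps power2_eq_square)
      show "- (2 * (f x * f' x + K * (f x * f x)) * exp (2 * K * x)) \<le> 0"
        using ff'[OF x] by (simp add: abs_le_iff)
    qed
    then show ?thesis by simp
  qed
  have abs_low: "f 0 * exp (- K * s) \<le> \<bar>f s\<bar>" if "0 \<le> s" for s
  proof -
    have "(f 0 * exp (- K * s))\<^sup>2 = (f 0)\<^sup>2 * exp (- (2 * K * s))"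
      by (simp add: power_mult_distrib exp_of_nat_mult[of 2, symmetric] mult_ac)
    also have "\<dots> \<le> (f s)\<^sup>2 * exp (2 * K * s) * exp (- (2 * K * s))"
      using low[OF that] by (intro mult_right_mono) auto
    also have "\<dots> = (\<bar>f s\<bar>)\<^sup>2" by (simp add: mult.assoc exp_add[symmetric])
    finally show ?thesis by (rule power2_le_imp_le) simp
  qed
  have "0 \<le> f t"
  proof (cases "f 0 = 0")
    case True
    have "(f t)\<^sup>2 * exp (- 2 * K * t) \<le> (f 0)\<^sup>2 * exp (- 2 * K * 0)"
    proof (rule nonincreasing_within[OF t])
      fix x :: real assume x: "0 \<le> x"
      show "((\<lambda>x. (f x)\<^sup>2 * exp (- 2 * K * x)) has_real_derivative
          2 * (f x * f' x - K * (f x * f x)) * exp (- 2 * K * x)) (at x within {0..t})"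
        by (rule derivative_eq_intros d[OF x] refl)+ (simp add: algebra_simps power2_eq_square)
      have "2 * (f x * f' x - K * (f x * f x)) \<le> 0"
        using mult_left_mono[OF abs_le_D1[OF ff'[OF x]], of 2] unfolding right_diff_distrib diff_le_0_iff_le by simp
      then show "2 * (f x * f' x - K * (f x * f x)) * exp (- 2 * K * x) \<le> 0"
        by (rule mult_nonpos_nonneg) simp
    qed
    then show ?thesis using True by (simp add: mult_le_0_iff)
  next
    case False
    show ?thesis
    proof (rule ccontr)
      assume "\<not> 0 \<le> f t"
      moreover have "continuous_on {0..t} f"
        using d by (auto simp: continuous_on_eq_continuous_within intro!: DERIV_continuous)
      ultimately obtain s where s: "0 \<le> s" "s \<le> t" "f s = 0"
        using IVT2'[of f t 0 0] f0 t by auto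
      have "0 < f 0 * exp (- K * s)" using False f0 by simp
      then show False using abs_low[OF s(1)] s(3) by simp
    qed
  qed
  then show ?thesis using abs_low[OF t] by simp
qed

lemma abs_sin_diff_le: "\<bar>sin x - sin y\<bar> \<le> \<bar>x - y\<bar>" for x y :: real
  using field_differentiable_bound[of UNIV sin cos 1 x y]
  by (simp add: DERIV_sin abs_cos_le_one)

section \<open>Dynamics with identical frequencies\<close>

locale identical_winfree =
  fixes n :: nat and \<nu> \<kappa> :: real and \<omega> :: "real ^ 'N::finite" and \<Theta> :: "real \<Rightarrow> real ^ 'N"
  assumes n: "n \<ge> 1" and \<nu>: "0 < \<nu>" and \<omega>: "\<And>i. \<omega> $ i = \<nu>" and \<kappa>: "0 < \<kappa>"
    and \<kappa>_less: "\<kappa> * wallis_ratio n < \<nu> / 2"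
    and solution: "winfree_global_solution n \<kappa> \<omega> \<Theta>"
begin

definition k :: real where "k = \<kappa> * wallis_ratio n / \<nu>"

definition mean_hump :: "real \<Rightarrow> real" where
  "mean_hump t = (\<Sum>j\<in>UNIV. hump n (\<Theta> t $ j)) / real CARD('N)"

lemma k_bounds: "0 < k" "k < 1 / 2"
  using \<nu> \<kappa> \<kappa>_less wallis_ratio_pos[of n] by (simp_all add: k_def field_simps)

lemma mean_hump_bounds: "0 \<le> mean_hump t" "mean_hump t \<le> 1"
proof -
  show "0 \<le> mean_hump t" unfolding mean_hump_def by (simp add: sum_nonneg hump_nonneg)
  have "(\<Sum>j\<in>UNIV. hump n (\<Theta> t $ j)) \<le> (\<Sum>j\<in>(UNIV :: 'N set). 1)"
    by (intro sum_mono hump_le_1)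
  then show "mean_hump t \<le> 1" unfolding mean_hump_def by (simp add: divide_le_eq)
qed

lemma phase_deriv:
  assumes "0 \<le> t"
  shows "((\<lambda>t. \<Theta> t $ i) has_real_derivative \<nu> * (1 - k * mean_hump t * sin (\<Theta> t $ i)))
    (at t within {0..})"
proof -
  have "((\<lambda>t. \<Theta> t $ i) has_vector_derivative winfree_field n \<kappa> \<omega> (\<Theta> t) $ i) (at t within {0..})"
    using solution assms unfolding winfree_global_solution_def
    by (intro bounded_linear.has_vector_derivative[OF bounded_linear_vec_nth]) auto
  moreover have "winfree_field n \<kappa> \<omega> (\<Theta> t) $ i = \<nu> * (1 - k * mean_hump t * sin (\<Theta> t $ i))"
    using \<nu> unfolding winfree_field_def sensitivity_def influence_eq_hump
    by (simp add: \<omega> k_def mean_hump_def sum_distrib_right[symmetric] sum_distrib_left[symmetric]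
        sum_negf field_simps)
  ultimately show ?thesis by (simp add: has_real_derivative_iff_has_vector_derivative)
qed

text \<open>The mean influence is common to both phases and sin is 1-Lipschitz, so the difference
  changes at relative rate at most \<open>\<nu> * k\<close>. This yields both the preserved order
  and the lower exponential bound on R.\<close>

lemma phase_diff_lower_bound:
  assumes "\<Theta> 0 $ j \<le> \<Theta> 0 $ i" "0 \<le> t"
  shows "(\<Theta> 0 $ i - \<Theta> 0 $ j) * exp (- (\<nu> * k) * t) \<le> \<Theta> t $ i - \<Theta> t $ j"
proof (rule linear_growth_lower_bound[where f' = "\<lambda>t. \<nu> * k * mean_hump t * (sin (\<Theta> t $ j) - sin (\<Theta> t $ i))"])
  fix s :: real assume s: "0 \<le> s"
  show "((\<lambda>t. \<Theta> t $ i - \<Theta> t $ j) has_real_derivative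
      \<nu> * k * mean_hump s * (sin (\<Theta> s $ j) - sin (\<Theta> s $ i))) (at s within {0..})"
    by (rule DERIV_cong[OF DERIV_diff[OF phase_deriv[OF s] phase_deriv[OF s]]])
      (simp add: algebra_simps)
  have "\<nu> * k * mean_hump s * \<bar>sin (\<Theta> s $ j) - sin (\<Theta> s $ i)\<bar>
      \<le> \<nu> * k * 1 * \<bar>\<Theta> s $ j - \<Theta> s $ i\<bar>"
    using \<nu> k_bounds mean_hump_bounds[of s] abs_sin_diff_le
    by (intro mult_mono mult_nonneg_nonneg) auto
  then show "\<bar>\<nu> * k * mean_hump s * (sin (\<Theta> s $ j) - sin (\<Theta> s $ i))\<bar>
      \<le> \<nu> * k * \<bar>\<Theta> s $ i - \<Theta> s $ j\<bar>"
    using \<nu> k_bounds mean_hump_bounds[of s] by (simp add: abs_mult abs_minus_commute)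
qed (use assms in auto)

lemma phase_order:
  assumes "\<Theta> 0 $ j \<le> \<Theta> 0 $ i" "0 \<le> t"
  shows "\<Theta> t $ j \<le> \<Theta> t $ i"
proof -
  have "0 \<le> (\<Theta> 0 $ i - \<Theta> 0 $ j) * exp (- (\<nu> * k) * t)" using assms by simp
  then show ?thesis using phase_diff_lower_bound[OF assms] by linarith
qed

end

text \<open>Phases that are extremal at time 0 stay extremal, so fixing their indices turns the
  half-diameter, a difference of a maximum and a minimum, into a differentiable function.\<close>

locale extremal_winfree = identical_winfree +
  fixes hi lo
  assumes hi: "\<And>j. \<Theta> 0 $ j \<le> \<Theta> 0 $ hi" and lo: "\<And>j. \<Theta> 0 $ lo \<le> \<Theta> 0 $ j"
begin

definition R :: "real \<Rightarrow> real" where "R t = (\<Theta> t $ hi - \<Theta> t $ lo) / 2"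

definition \<phi> :: "real \<Rightarrow> real" where "\<phi> t = (\<Theta> t $ hi + \<Theta> t $ lo) / 2"

section \<open>Equations for the half-diameter and the midpoint\<close>

lemma half_diameter_eq:
  assumes "0 \<le> t"
  shows "half_diameter (\<Theta> t) = R t"
proof -
  have "(MAX i. \<Theta> t $ i) = \<Theta> t $ hi" "(MIN i. \<Theta> t $ i) = \<Theta> t $ lo"
    using phase_order[OF hi assms] phase_order[OF lo assms] by (auto intro!: Max_eqI Min_eqI)
  then show ?thesis by (simp add: half_diameter_def R_def)
qed

lemma R_lower_bound: "0 \<le> t \<Longrightarrow> R 0 * exp (- (\<nu> * k) * t) \<le> R t"
  using phase_diff_lower_bound[OF hi, of t lo] by (simp add: R_def)

lemma hi_eq: "\<Theta> t $ hi = \<phi> t + R t" and lo_eq: "\<Theta> t $ lo = \<phi> t - R t"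
  by (simp_all add: R_def \<phi>_def field_simps)

lemma R_deriv:
  assumes "0 \<le> t"
  shows "(R has_real_derivative - (\<nu> * k * mean_hump t * cos (\<phi> t) * sin (R t))) (at t within {0..})"
  unfolding R_def[abs_def]
  by (rule DERIV_cong[OF DERIV_cdivide[OF DERIV_diff[OF phase_deriv[OF assms] phase_deriv[OF assms]]]])
    (simp add: hi_eq lo_eq sin_add sin_diff R_def[symmetric] algebra_simps)

lemma \<phi>_deriv:
  assumes "0 \<le> t"
  shows "(\<phi> has_real_derivative \<nu> * (1 - k * mean_hump t * sin (\<phi> t) * cos (R t))) (at t within {0..})"
  unfolding \<phi>_def[abs_def]
  by (rule DERIV_cong[OF DERIV_cdivide[OF DERIV_add[OF phase_deriv[OF assms] phase_deriv[OF assms]]]])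
    (simp add: hi_eq lo_eq sin_add sin_diff \<phi>_def[symmetric] field_simps)

lemma \<phi>_speed:
  assumes st: "0 \<le> s" "s \<le> t"
  shows "\<nu> / 2 * (t - s) \<le> \<phi> t - \<phi> s"
proof -
  have "\<nu> / 2 * t - \<phi> t \<le> \<nu> / 2 * s - \<phi> s"
  proof (rule nonincreasing_within[OF st(2), of "\<lambda>t. \<nu> / 2 * t - \<phi> t"])
    fix x assume x: "s \<le> x"
    then have x0: "0 \<le> x" using st by simp
    have "(\<phi> has_real_derivative \<nu> * (1 - k * mean_hump x * sin (\<phi> x) * cos (R x))) (at x within {s..t})"
      using \<phi>_deriv[OF x0] by (rule DERIV_subset) (use st in auto)
    from DERIV_diff[OF DERIV_cmult[OF DERIV_ident] this]
    show "((\<lambda>t. \<nu> / 2 * t - \<phi> t) has_real_derivative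
        \<nu> / 2 * 1 - \<nu> * (1 - k * mean_hump x * sin (\<phi> x) * cos (R x))) (at x within {s..t})" .
    have "k * mean_hump x * \<bar>sin (\<phi> x)\<bar> * \<bar>cos (R x)\<bar> \<le> 1 / 2 * 1 * 1 * 1"
      using k_bounds mean_hump_bounds[of x] by (intro mult_mono mult_nonneg_nonneg) auto
    moreover have "k * mean_hump x * sin (\<phi> x) * cos (R x) \<le> \<bar>k * mean_hump x * sin (\<phi> x) * cos (R x)\<bar>"
      by (rule abs_ge_self)
    moreover have "\<dots> = k * mean_hump x * \<bar>sin (\<phi> x)\<bar> * \<bar>cos (R x)\<bar>"
      using k_bounds mean_hump_bounds[of x] by (simp add: abs_mult)
    ultimately have "\<nu> * (1 / 2) \<le> \<nu> * (1 - k * mean_hump x * sin (\<phi> x) * cos (R x))"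
      using \<nu> by (intro mult_left_mono) auto
    then show "\<nu> / 2 * 1 - \<nu> * (1 - k * mean_hump x * sin (\<phi> x) * cos (R x)) \<le> 0" by simp
  qed
  then show ?thesis unfolding right_diff_distrib by linarith
qed

lemma mean_hump_close:
  assumes t: "0 \<le> t" and R: "R t \<le> \<alpha>"
  shows "\<bar>mean_hump t - hump n (\<phi> t)\<bar> \<le> hump_slope n / 2 * \<alpha>"
proof -
  have "\<bar>hump n (\<Theta> t $ j) - hump n (\<phi> t)\<bar> \<le> hump_slope n / 2 * \<alpha>" for j
  proof -
    have "\<bar>\<Theta> t $ j - \<phi> t\<bar> \<le> R t"
      using phase_order[OF hi t, of j] phase_order[OF lo t, of j] unfolding hi_eq lo_eq by auto
    then have "hump_slope n / 2 * \<bar>\<Theta> t $ j - \<phi> t\<bar> \<le> hump_slope n / 2 * \<alpha>"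
      using R hump_slope_ge_half[OF n] by (intro mult_left_mono) auto
    then show ?thesis using hump_lipschitz[OF n, of "\<Theta> t $ j" "\<phi> t"] by linarith
  qed
  then have "\<bar>\<Sum>j\<in>UNIV. hump n (\<Theta> t $ j) - hump n (\<phi> t)\<bar>
      \<le> real CARD('a) * (hump_slope n / 2 * \<alpha>)"
    by (intro order_trans[OF sum_abs] sum_bounded_above) auto
  moreover have "mean_hump t - hump n (\<phi> t)
      = (\<Sum>j\<in>UNIV. hump n (\<Theta> t $ j) - hump n (\<phi> t)) / real CARD('a)"
    by (simp add: mean_hump_def sum_subtractf field_simps)
  ultimately show ?thesis by (simp add: abs_divide divide_le_eq mult.commute)
qed

text \<open>The potential \<open>G\<close> converts the angular growth rate into a Lyapunov function.  The tangent of
  the half-angle is used because it turns the equation for \<open>R\<close> into a linear one.\<close>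

lemma tan_R_bound:
  assumes T: "0 \<le> T" and R: "\<And>t. 0 \<le> t \<Longrightarrow> t \<le> T \<Longrightarrow> R t \<le> \<alpha>"
    and R0: "0 \<le> R 0" and \<alpha>: "\<alpha> \<le> pi / 2"
  shows "tan (R T / 2)
    \<le> tan (R 0 / 2) * exp (k * integral {\<phi> 0..\<phi> T} (growth_rate n (hump_slope n / 2 * \<alpha>)))"
proof -
  define g where "g = growth_rate n (hump_slope n / 2 * \<alpha>)"
  define G where "G x = integral {\<phi> 0..x} g" for x
  define V where "V t = tan (R t / 2) * exp (- (k * G (\<phi> t)))" for t
  define V' where "V' t = exp (- (k * G (\<phi> t))) * tan (R t / 2) * (\<nu> * k)
    * (- (mean_hump t * cos (\<phi> t)) - g (\<phi> t) * (1 - k * mean_hump t * sin (\<phi> t) * cos (R t)))" for t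
  have "V T \<le> V 0"
  proof (rule nonincreasing_within[OF T])
    fix t assume t: "0 \<le> t" "t \<le> T"
    have "0 \<le> R 0 * exp (- (\<nu> * k) * t)" using R0 by simp
    then have Rt: "0 \<le> R t" "R t \<le> pi / 2" using R_lower_bound[OF t(1)] R[OF t] \<alpha> by linarith+
    then have cos_pos: "0 < cos (R t / 2)"
      using pi_gt_zero by (intro cos_gt_zero_pi) linarith+
    \<comment> \<open>\<open>G\<close> is differentiable only within
      \<open>{\<phi> 0..\<phi> T}\<close>, so the chain rule needs the image of
      \<open>\<phi>\<close> to lie there.\<close>
    have "\<phi> 0 \<le> \<phi> s" "\<phi> s \<le> \<phi> T" if "0 \<le> s" "s \<le> T" for s
      using \<phi>_speed[of 0 s] \<phi>_speed[of s T] \<nu> that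
      by (smt (verit) mult_nonneg_nonneg divide_nonneg_nonneg)+
    then have range: "\<phi> ` {0..T} \<subseteq> {\<phi> 0..\<phi> T}" by auto
    have \<phi>t: "\<phi> t \<in> {\<phi> 0..\<phi> T}" by (rule subsetD[OF range imageI]) (use t in simp)
    have dR: "(R has_real_derivative - (\<nu> * k * mean_hump t * cos (\<phi> t) * sin (R t))) (at t within {0..T})"
      using R_deriv[OF t(1)] by (rule DERIV_subset) auto
    have d\<phi>: "(\<phi> has_real_derivative \<nu> * (1 - k * mean_hump t * sin (\<phi> t) * cos (R t))) (at t within {0..T})"
      using \<phi>_deriv[OF t(1)] by (rule DERIV_subset) auto
    have "(G has_real_derivative g (\<phi> t)) (at (\<phi> t) within {\<phi> 0..\<phi> T})"
      unfolding G_def g_def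
      by (intro integral_has_real_derivative continuous_intros \<phi>t)
    then have "(G has_real_derivative g (\<phi> t)) (at (\<phi> t) within \<phi> ` {0..T})"
      using range by (rule DERIV_subset)
    from DERIV_image_chain[OF this d\<phi>]
    have dG: "((\<lambda>t. G (\<phi> t)) has_real_derivative
        g (\<phi> t) * (\<nu> * (1 - k * mean_hump t * sin (\<phi> t) * cos (R t)))) (at t within {0..T})"
      by (simp add: o_def)
    have "sin (R t) = 2 * tan (R t / 2) * (cos (R t / 2))\<^sup>2"
      using cos_pos sin_double[of "R t / 2"] by (simp add: tan_def power2_eq_square)
    then have "- (\<nu> * k * mean_hump t * cos (\<phi> t) * sin (R t)) / 2 * inverse ((cos (R t / 2))\<^sup>2)
        = - (\<nu> * k * mean_hump t * cos (\<phi> t)) * tan (R t / 2)"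
      using cos_pos by (simp add: field_simps)
    moreover have "((\<lambda>t. tan (R t / 2)) has_real_derivative
        - (\<nu> * k * mean_hump t * cos (\<phi> t) * sin (R t)) / 2 * inverse ((cos (R t / 2))\<^sup>2))
        (at t within {0..T})"
      using cos_pos by (auto intro!: derivative_eq_intros dR)
    ultimately have dtan: "((\<lambda>t. tan (R t / 2)) has_real_derivative
        - (\<nu> * k * mean_hump t * cos (\<phi> t)) * tan (R t / 2)) (at t within {0..T})" by (simp only:)
    show "(V has_real_derivative V' t) (at t within {0..T})"
      unfolding V_def[abs_def]
      by (rule derivative_eq_intros dtan dG refl)+ (simp add: V'_def algebra_simps)
    have "- (mean_hump t * cos (\<phi> t)) \<le> g (\<phi> t) * (1 - k * mean_hump t * sin (\<phi> t) * cos (R t))"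
      unfolding g_def using k_bounds mean_hump_bounds[of t] mean_hump_close[OF t(1) R[OF t]] Rt
      by (intro growth_rate_dominates) (auto intro!: cos_ge_zero)
    moreover have "0 \<le> tan (R t / 2)"
      using Rt by (simp add: tan_def cos_pos less_imp_le sin_ge_zero)
    ultimately show "V' t \<le> 0"
      unfolding V'_def using k_bounds \<nu> by (intro mult_nonneg_nonpos mult_nonneg_nonneg) auto
  qed
  moreover have "V 0 = tan (R 0 / 2)" by (simp add: V_def G_def)
  ultimately have "V T * exp (k * G (\<phi> T)) \<le> tan (R 0 / 2) * exp (k * G (\<phi> T))"
    by (intro mult_right_mono) auto
  then show ?thesis by (simp add: V_def G_def g_def mult.assoc exp_add[symmetric])
qed

lemma R_exp_decay:
  assumes n2: "n \<ge> 2" and \<alpha>: "0 < \<alpha>" "\<alpha> \<le> pi / 2"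
    and small: "\<alpha> * hump_slope n < pi / (2 * wallis_ratio n) * (real n / (real n + 1)) - 1 / 2 ^ n"
    and init: "R 0 * exp (\<alpha> * hump_slope n + 1 / 2 ^ (n - 1)) < \<alpha>" and R0: "0 < R 0"
  obtains B L where "0 < B" "B < \<alpha>" "0 < L" "\<And>t. 0 \<le> t \<Longrightarrow> R t \<le> B * exp (- L * t)"
proof -
  note conclude = that
  define \<epsilon> where "\<epsilon> = hump_slope n / 2 * \<alpha>"
  define E where "E = \<alpha> * hump_slope n + 1 / 2 ^ (n - 1)"
  have slope: "0 < hump_slope n" using hump_slope_ge_half[OF n] by simp
  then have \<epsilon>: "0 \<le> \<epsilon>" and E0: "0 \<le> E" using \<alpha> by (simp_all add: \<epsilon>_def E_def)
  have small': "2 * \<epsilon> < pi / (2 * wallis_ratio n) * (real n / (real n + 1)) - 1 / 2 ^ n"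
    using small by (simp add: \<epsilon>_def mult.commute)
  obtain C l where l: "l > 0"
    and short: "\<And>a b. a \<le> b \<Longrightarrow> integral {a..b} (growth_rate n \<epsilon>) \<le> 4 * (1 / 2 ^ n + \<epsilon>)"
    and long: "\<And>a b. a \<le> b \<Longrightarrow> integral {a..b} (growth_rate n \<epsilon>) \<le> C - l * (b - a)"
    by (rule growth_rate_integral_bound[OF n2 \<epsilon> small']) (rule that; assumption)
  have pow: "2 * (1 / 2 ^ n) = (1 :: real) / 2 ^ (n - 1)"
    using n by (cases n) auto
  have \<phi>_mono: "\<phi> 0 \<le> \<phi> t" if "0 \<le> t" for t
    using \<phi>_speed[of 0 t] \<nu> that by (smt (verit) mult_nonneg_nonneg divide_nonneg_nonneg)
  have kE: "k * integral {\<phi> 0..\<phi> t} (growth_rate n \<epsilon>) \<le> E" if "0 \<le> t" for t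
  proof -
    have "k * integral {\<phi> 0..\<phi> t} (growth_rate n \<epsilon>) \<le> k * (4 * (1 / 2 ^ n + \<epsilon>))"
      using k_bounds by (intro mult_left_mono short \<phi>_mono that) auto
    \<comment> \<open>Here k < 1/2 reduces the bound on the integral to exactly the exponent in the
      hypothesis on R(0).\<close>
    also have "\<dots> \<le> 1 / 2 * (4 * (1 / 2 ^ n + \<epsilon>))"
      using k_bounds \<epsilon> by (intro mult_right_mono) auto
    also have "\<dots> = E" unfolding E_def \<epsilon>_def pow[symmetric] by (simp add: algebra_simps)
    finally show ?thesis .
  qed
  define B1 where "B1 = exp E * R 0"
  have B1: "0 < B1" "B1 < \<alpha>" "R 0 \<le> B1"
    using init R0 E0 by (simp_all add: B1_def E_def mult.commute)
  have tan_R0: "0 < tan (R 0 / 2)" using R0 B1 \<alpha> by (intro tan_gt_zero) auto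
  have R_nonneg: "0 \<le> R t" if "0 \<le> t" for t
    using R_lower_bound[OF that] R0 by (smt (verit) exp_gt_zero mult_pos_pos)
  have upper: "R T \<le> B1" if T: "0 \<le> T" and R: "\<And>t. 0 \<le> t \<Longrightarrow> t \<le> T \<Longrightarrow> R t \<le> \<alpha>" for T
  proof (rule ccontr)
    assume "\<not> R T \<le> B1"
    then have less: "exp E * (R 0 / 2) < R T / 2" by (simp add: B1_def)
    have "tan (R T / 2) \<le> tan (R 0 / 2) * exp (k * integral {\<phi> 0..\<phi> T} (growth_rate n \<epsilon>))"
      unfolding \<epsilon>_def using R0 \<alpha> by (intro tan_R_bound T R) auto
    also have "\<dots> \<le> tan (R 0 / 2) * exp E"
      using tan_R0 kE[OF T] by (intro mult_left_mono) auto
    also have "\<dots> = exp E * tan (R 0 / 2)" by simp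
    also have "\<dots> \<le> tan (exp E * (R 0 / 2))"
      using E0 R0 B1 \<alpha> by (intro scale_tan_le) (auto simp: B1_def)
    also have "\<dots> < tan (R T / 2)"
    proof (rule tan_monotone[OF _ less])
      have "0 < exp E * (R 0 / 2)" using R0 by simp
      then show "- (pi / 2) < exp E * (R 0 / 2)" using pi_gt_zero by linarith
      show "R T / 2 < pi / 2" using R[OF T] \<alpha> pi_gt_zero by simp
    qed
    finally show False by simp
  qed
  have cont: "continuous_on {0..T} R" for T
  proof -
    have "(R has_real_derivative - (\<nu> * k * mean_hump t * cos (\<phi> t) * sin (R t))) (at t within {0..T})"
      if "t \<in> {0..T}" for t
      by (rule DERIV_subset[OF R_deriv]) (use that in auto)
    then show ?thesis by (intro DERIV_continuous_on) auto
  qed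
  have below: "R T \<le> \<alpha>" if T: "0 \<le> T" for T
  proof (rule ccontr)
    assume neg: "\<not> R T \<le> \<alpha>"
    \<comment> \<open>\<open>S\<close> is compact and so has a first element \<open>s\<close>. Up to
      \<open>s\<close> the bound by \<alpha> holds, hence \<open>upper\<close> applies at
      \<open>s\<close> and contradicts \<open>R s = \<alpha>\<close>.\<close>
    define S where "S = {0..T} \<inter> R -` {\<alpha>}"
    have "closed S" unfolding S_def by (intro continuous_closed_preimage cont) auto
    then have "compact S" unfolding S_def by (metis Int_lower1 bounded_closed_interval bounded_subset compact_eq_bounded_closed)
    moreover have "S \<noteq> {}"
      using IVT'[of R 0 \<alpha> T] neg B1 T cont unfolding S_def by auto
    ultimately obtain s where s: "s \<in> S" "\<And>t. t \<in> S \<Longrightarrow> s \<le> t"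
      using compact_attains_inf by metis
    have "R t \<le> \<alpha>" if t: "0 \<le> t" "t \<le> s" for t
    proof (rule ccontr)
      assume "\<not> R t \<le> \<alpha>"
      then obtain r where r: "0 \<le> r" "r \<le> t" "R r = \<alpha>"
        using IVT'[of R 0 \<alpha> t] B1 t cont by auto
      then have "r \<in> S" using s(1) t unfolding S_def by auto
      then have "r = t" using s(2) r t by force
      then show False using r \<open>\<not> R t \<le> \<alpha>\<close> by simp
    qed
    then have "R s \<le> B1" using s(1) by (intro upper) (auto simp: S_def)
    then show False using s(1) B1 by (simp add: S_def)
  qed
  \<comment> \<open>The 2 comes from R/2 <= tan(R/2) and \<open>C\<close> from the incomplete
    period. The rate below contains \<open>\<nu> / 2\<close> because the midpoint advances at least
    that fast.\<close>
  define B2 where "B2 = 2 * tan (R 0 / 2) * exp (k * C)"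
  have B2: "0 < B2" using tan_R0 by (simp add: B2_def)
  have decay: "R t \<le> B2 * exp (- (k * l * \<nu> / 2) * t)" if t: "0 \<le> t" for t
  proof -
    have Rt: "R t \<le> \<alpha>" using below[OF t] .
    have "R t / 2 \<le> tan (R t / 2)"
      using R_nonneg[OF t] Rt \<alpha> pi_gt_zero by (intro le_tan) auto
    also have "\<dots> \<le> tan (R 0 / 2) * exp (k * integral {\<phi> 0..\<phi> t} (growth_rate n \<epsilon>))"
      unfolding \<epsilon>_def using R0 \<alpha> by (intro tan_R_bound t below) auto
    also have "\<dots> \<le> tan (R 0 / 2) * exp (k * (C - l * (\<nu> / 2 * t)))"
    proof -
      have "l * (\<nu> / 2 * t) \<le> l * (\<phi> t - \<phi> 0)"
        using \<phi>_speed[of 0 t] t l by (intro mult_left_mono) auto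
      then have "integral {\<phi> 0..\<phi> t} (growth_rate n \<epsilon>) \<le> C - l * (\<nu> / 2 * t)"
        using long[OF \<phi>_mono[OF t]] by linarith
      then show ?thesis using k_bounds tan_R0 by simp
    qed
    also have "\<dots> = B2 * exp (- (k * l * \<nu> / 2) * t) / 2"
      by (simp add: B2_def exp_add[symmetric] algebra_simps)
    finally show ?thesis by simp
  qed
  have rate: "0 < k * l * \<nu> / 2" using k_bounds l \<nu> by simp
  show ?thesis
  proof (rule exp_decay_below_bound[OF B1(1) B2 B1(2) rate, of R])
    show "R t \<le> B1" if "0 \<le> t" for t using upper below that by simp
    show "R t \<le> B2 * exp (- (k * l * \<nu> / 2) * t)" if "0 \<le> t" for t using decay[OF that] .
    show ?thesis if "0 < B" "B < \<alpha>" "0 < L" "\<And>t. 0 \<le> t \<Longrightarrow> R t \<le> B * exp (- L * t)" for B L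
      using conclude that by blast
  qed
qed

end

theorem theorem5p1:
  fixes n :: nat and \<nu> \<kappa> \<alpha> :: real
    and \<omega> :: "real ^ 'N::finite"
    and \<Theta> :: "real \<Rightarrow> real ^ 'N"
  assumes "n \<ge> 2"
    and "\<nu> > 0"
    and "\<And>i. \<omega> $ i = \<nu>"
    and "0 < \<kappa>" and "\<kappa> < \<nu> / (2 ^ (n + 1) * winfree_coeff n)"
    and "0 < \<alpha>"
    and "\<alpha> < (pi / (2 ^ (n + 1) * winfree_coeff n) * (real n / (real n + 1)) - 1 / 2 ^ n)
              * (1 / sqrt (2 * real n - 1))
              * (2 * real n / (2 * real n - 1)) ^ (n - 1)"
    and "half_diameter (\<Theta> 0)
           < \<alpha> * exp (- \<alpha> * sqrt (2 * real n - 1) * ((2 * real n - 1) / (2 * real n)) ^ (n - 1)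
                        - 1 / 2 ^ (n - 1))"
    and "winfree_global_solution n \<kappa> \<omega> \<Theta>"
  shows "\<exists>\<beta>1 \<beta>2 \<Lambda>1 \<Lambda>2 :: real. \<beta>1 > 0 \<and> \<beta>2 > 0 \<and> \<Lambda>1 > 0 \<and> \<Lambda>2 > 0 \<and>
    (\<forall>t\<ge>0. \<beta>1 * exp (- \<Lambda>1 * t) * half_diameter (\<Theta> 0) \<le> half_diameter (\<Theta> t)
          \<and> half_diameter (\<Theta> t) \<le> \<beta>2 * exp (- \<Lambda>2 * t) * half_diameter (\<Theta> 0)
          \<and> \<beta>2 * exp (- \<Lambda>2 * t) * half_diameter (\<Theta> 0) < \<alpha>)"
proof -
  define A where "A = wallis_ratio n"
  have A2: "2 \<le> A" and coeff: "2 ^ (n + 1) * winfree_coeff n = 2 * A"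
    using wallis_ratio_ge_2[of n] assms(1) by (simp_all add: A_def wallis_ratio_def)
  have \<kappa>A: "\<kappa> * A < \<nu> / 2"
    using assms(5) A2 unfolding coeff by (simp add: field_simps)
  have "(MAX i. \<Theta> 0 $ i) \<in> range (\<lambda>i. \<Theta> 0 $ i)" by (intro Max_in) auto
  then obtain hi where "(MAX i. \<Theta> 0 $ i) = \<Theta> 0 $ hi" by (rule imageE)
  then have hi: "\<Theta> 0 $ j \<le> \<Theta> 0 $ hi" for j by (metis Max_ge finite finite_imageI rangeI)
  have "(MIN i. \<Theta> 0 $ i) \<in> range (\<lambda>i. \<Theta> 0 $ i)" by (intro Min_in) auto
  then obtain lo where "(MIN i. \<Theta> 0 $ i) = \<Theta> 0 $ lo" by (rule imageE)
  then have lo: "\<Theta> 0 $ lo \<le> \<Theta> 0 $ j" for j by (metis Min_le finite finite_imageI rangeI)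
  interpret extremal_winfree n \<nu> \<kappa> \<omega> \<Theta> hi lo
    using assms hi lo \<kappa>A by unfold_locales (auto simp: A_def)
  define X where "X = pi / (2 * A) * (real n / (real n + 1)) - 1 / 2 ^ n"
  have slope: "hump_slope n \<ge> 1 / 2" using assms(1) by (intro hump_slope_ge_half) simp
  have "1 / sqrt (2 * real n - 1) * (2 * real n / (2 * real n - 1)) ^ (n - 1) = 1 / hump_slope n"
    by (simp add: hump_slope_def power_divide)
  then have "\<alpha> < X * (1 / hump_slope n)"
    using assms(7) unfolding coeff X_def by (simp only: mult.assoc)
  then have small: "\<alpha> * hump_slope n < X" using slope by (simp add: field_simps)
  \<comment> \<open>The crude bounds slope >= 1/2 and A >= 2 already give \<alpha> <= pi/2, which
    keeps R/2 away from the pole of tan and \<open>cos R\<close> nonnegative.\<close>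
  have "\<alpha> * (1 / 2) \<le> \<alpha> * hump_slope n" using assms(6) slope by (intro mult_left_mono) auto
  moreover have "X \<le> pi / (2 * A)"
  proof -
    have "pi / (2 * A) * (real n / (real n + 1)) \<le> pi / (2 * A) * 1"
      using A2 by (intro mult_left_mono) auto
    then show ?thesis unfolding X_def by (smt (verit) zero_le_divide_1_iff zero_le_power)
  qed
  moreover have "pi / (2 * A) \<le> pi / (2 * 2)" using A2 by (intro divide_left_mono) auto
  ultimately have \<alpha>: "\<alpha> \<le> pi / 2" using small by linarith
  have "exp (- \<alpha> * sqrt (2 * real n - 1) * ((2 * real n - 1) / (2 * real n)) ^ (n - 1) - 1 / 2 ^ (n - 1))
      = exp (- (\<alpha> * hump_slope n + 1 / 2 ^ (n - 1)))"
    by (simp add: hump_slope_def)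
  then have "R 0 < \<alpha> * exp (- (\<alpha> * hump_slope n + 1 / 2 ^ (n - 1)))"
    using assms(8) unfolding half_diameter_eq[OF order_refl] by (simp only:)
  then have init: "R 0 * exp (\<alpha> * hump_slope n + 1 / 2 ^ (n - 1)) < \<alpha>"
    unfolding exp_minus by (simp add: field_simps)
  have low: "1 * exp (- (\<nu> * k) * t) * half_diameter (\<Theta> 0) \<le> half_diameter (\<Theta> t)" if "0 \<le> t" for t
    using R_lower_bound[OF that] half_diameter_eq[OF that] half_diameter_eq[of 0]
    by (simp add: mult.commute)
  have rate: "0 < \<nu> * k" using \<nu> k_bounds by simp
  show ?thesis
  \<comment> \<open>The upper prefactor will be \<open>B / R 0\<close>. If all phases start equal
    they stay equal, and all four constants can be 1.\<close>
  proof (cases "R 0 = 0")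
    case True
    have "R t = 0" if "0 \<le> t" for t
      using phase_order[OF _ that, of hi lo] R_lower_bound[OF that] True by (simp add: R_def)
    then have "half_diameter (\<Theta> t) = 0" if "0 \<le> t" for t
      using half_diameter_eq that by simp
    then show ?thesis using assms(6) by (intro exI[of _ 1]) auto
  next
    case False
    then have R0: "0 < R 0" using hi[of lo] by (simp add: R_def)
    obtain B L where B: "0 < B" "B < \<alpha>" "0 < L" "\<And>t. 0 \<le> t \<Longrightarrow> R t \<le> B * exp (- L * t)"
      by (rule R_exp_decay[OF assms(1) assms(6) \<alpha> small[unfolded X_def A_def] init R0]) (rule that; assumption)
    have scaled: "B / R 0 * exp (- L * t) * half_diameter (\<Theta> 0) = B * exp (- L * t)" for t
      using R0 half_diameter_eq[of 0] by simp
    have "B * exp (- L * t) < \<alpha>" if "0 \<le> t" for t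
    proof -
      have "B * exp (- L * t) \<le> B * 1" using B that by (intro mult_left_mono) auto
      then show ?thesis using B(2) by linarith
    qed
    then have "half_diameter (\<Theta> t) \<le> B / R 0 * exp (- L * t) * half_diameter (\<Theta> 0)
        \<and> B / R 0 * exp (- L * t) * half_diameter (\<Theta> 0) < \<alpha>" if "0 \<le> t" for t
      unfolding scaled using B(4) half_diameter_eq that by simp
    moreover have "0 < B / R 0" using B R0 by simp
    ultimately show ?thesis using low rate B(3) zero_less_one by blast
  qed
qed

end
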